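(* For every integer $t \geq 3$ and every integer $s\ge 0$, $e_{3,t+1}(s) \leq e_{3,t}(s)$.
   Context: All graphs are finite and simple. A $(3,t)$-system is a pair $(H,\mathcal{F})$ where $H$ is a triangle-free graph and $\mathcal{F}$ is a family (without repeated elements) of subsets of $V(H)$, each of size exactly $t$, such that every $S\in\mathcal{F}$ is a maximal independent set of $H$, and any two distinct sets in $\mathcal{F}$ intersect. For $t\ge 3$ and $s\ge0$, $e_{3,t}(s)$ is the minimum number of edges $e(H)$ over all $(3,t)$-systems $(H,\mathcal{F})$ with $|\mathcal{F}|=s$. *)

theory Defs
  imports "HOL-Library.Ramsey"
begin

definition simple_graph :: "'a set \<Rightarrow> 'a set set \<Rightarrow> bool" where
  "simple_graph V E \<longleftrightarrow> finite V \<and> E \<subseteq> [V]\<^bsup>2\<^esup>"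

definition triangle_free :: "'a set \<Rightarrow> 'a set set \<Rightarrow> bool" where
  "triangle_free V E \<longleftrightarrow> \<not> (\<exists>K \<in> [V]\<^bsup>3\<^esup>. clique K E)"

definition maximal_independent_set :: "'a set \<Rightarrow> 'a set set \<Rightarrow> 'a set \<Rightarrow> bool" where
  "maximal_independent_set V E S \<longleftrightarrow> S \<subseteq> V \<and> indep S E \<and>
     \<not> (\<exists>T. S \<subset> T \<and> T \<subseteq> V \<and> indep T E)"

definition system3 :: "nat \<Rightarrow> 'a set \<Rightarrow> 'a set set \<Rightarrow> 'a set set \<Rightarrow> bool" where
  "system3 t V E F \<longleftrightarrow> simple_graph V E \<and> triangle_free V E \<and> F \<subseteq> [V]\<^bsup>t\<^esup> \<and>
     (\<forall>S\<in>F. maximal_independent_set V E S) \<and>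
     (\<forall>S\<in>F. \<forall>T\<in>F. S \<noteq> T \<longrightarrow> S \<inter> T \<noteq> {})"

text \<open>Every finite graph is isomorphic to one with vertices in \<open>nat\<close>, so minimising over graphs
  of this kind is minimising over all finite graphs.\<close>

definition system3_edge_counts :: "nat \<Rightarrow> nat \<Rightarrow> nat set" where
  "system3_edge_counts t s =
     {card E | (V :: nat set) E F. system3 t V E F \<and> card F = s}"

definition e3 :: "nat \<Rightarrow> nat \<Rightarrow> nat" where
  "e3 t s = Inf (system3_edge_counts t s)"

text \<open>For \<open>t \<ge> 3\<close> the infimum is a genuine minimum, never the junk value \<open>Inf {} = 0\<close>: take
  \<open>K\<^sub>s\<^sub>,\<^sub>s\<close> minus a perfect matching together with \<open>t - 2\<close> isolated vertices, and the sets
  consisting of a removed matching edge and all the isolated vertices.\<close>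

lemma system3_edge_counts_nonempty:
  assumes "t \<ge> 3"
  shows "system3_edge_counts t s \<noteq> {}"
proof -
  define I where "I = {2*s..<2*s+(t-2)}"
  define V where "V = {..<2*s} \<union> I"
  define E where "E = {{2*i, 2*j+1} | i j. i < s \<and> j < s \<and> i \<noteq> j}"
  define M where "M = (\<lambda>i::nat. {2*i, 2*i+1} \<union> I)"
  define F where "F = M ` {..<s}"
  have adj: "{x, y} \<in> E \<longleftrightarrow> x < 2*s \<and> y < 2*s \<and> x div 2 \<noteq> y div 2 \<and> even x \<noteq> even y" for x y
  proof
    assume "{x, y} \<in> E"
    then show "x < 2*s \<and> y < 2*s \<and> x div 2 \<noteq> y div 2 \<and> even x \<noteq> even y"
      unfolding E_def by (auto simp: doubleton_eq_iff)
  next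
    assume a: "x < 2*s \<and> y < 2*s \<and> x div 2 \<noteq> y div 2 \<and> even x \<noteq> even y"
    have E: "{2*i, 2*j+1} \<in> E" if "i < s" "j < s" "i \<noteq> j" for i j
      unfolding E_def using that by blast
    have d: "x div 2 < s" "y div 2 < s" using a by linarith+
    show "{x, y} \<in> E"
    proof (cases "even x")
      case True
      then have "2*(x div 2) = x" "2*(y div 2)+1 = y" using a by simp_all
      then show ?thesis using E[of "x div 2" "y div 2"] a d by simp
    next
      case False
      then have "2*(y div 2) = y" "2*(x div 2)+1 = x" using a by simp_all
      then show ?thesis using E[of "y div 2" "x div 2"] a d by (simp add: insert_commute)
    qed
  qed
  have inM: "x \<in> M i \<longleftrightarrow> x div 2 = i \<or> x \<in> I" for x i
  proof -
    have "x = 2*i \<or> x = 2*i+1 \<longleftrightarrow> x div 2 = i" by presburger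
    then show ?thesis unfolding M_def by blast
  qed
  have "simple_graph V E"
  proof -
    have "{2*i, 2*j+1} \<in> [V]\<^bsup>2\<^esup>" if "i < s" "j < s" for i j
      using that unfolding doubleton_in_nsets_2 V_def by (simp, presburger)
    then show ?thesis unfolding simple_graph_def E_def by (auto simp: V_def I_def)
  qed
  moreover have "triangle_free V E"
    unfolding triangle_free_def
  proof
    assume "\<exists>K \<in> [V]\<^bsup>3\<^esup>. clique K E"
    then obtain K where K: "card K = 3" "clique K E" unfolding nsets_def by blast
    then obtain x y z where "K = {x, y, z}" "x \<noteq> y" "y \<noteq> z" "x \<noteq> z"
      unfolding card_3_iff by blast
    then have "{x, y} \<in> E" "{y, z} \<in> E" "{x, z} \<in> E"
      using K unfolding clique_def by simp_all
    then show False unfolding adj by blast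
  qed
  moreover have "F \<subseteq> [V]\<^bsup>t\<^esup>"
  proof
    fix S assume "S \<in> F"
    then obtain i where i: "i < s" "S = M i" unfolding F_def by auto
    have "{2*i, 2*i+1} \<inter> I = {}" "finite I" "card I = t - 2" "card {2*i, 2*i+1} = 2"
      using i unfolding I_def by simp_all
    then have "card (M i) = t" "finite (M i)"
      using assms unfolding M_def by simp_all
    moreover have "M i \<subseteq> V" using i unfolding M_def V_def by simp
    ultimately show "S \<in> [V]\<^bsup>t\<^esup>"
      using i unfolding nsets_def by simp
  qed
  moreover have "maximal_independent_set V E S" if S: "S \<in> F" for S
  proof -
    obtain i where i: "i < s" "S = M i" using S unfolding F_def by auto
    have "S \<subseteq> V" using \<open>F \<subseteq> [V]\<^bsup>t\<^esup>\<close> S unfolding nsets_def by blast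
    moreover have "indep S E"
      unfolding indep_def
    proof (intro ballI impI notI)
      fix v w assume "v \<in> S" "w \<in> S" "{v, w} \<in> E"
      then show False unfolding i adj inM I_def by simp
    qed
    moreover have False if T: "S \<subset> T" "T \<subseteq> V" "indep T E" for T
    proof -
      obtain x where x: "x \<in> T" "x \<notin> S" using T by auto
      then have xs: "x < 2*s" "x div 2 \<noteq> i"
        using T i unfolding V_def by (auto simp: inM)
      define y where "y = (if even x then 2*i+1 else 2*i)"
      have y: "y \<in> S" unfolding y_def i M_def by simp
      have "{x, y} \<in> E"
        unfolding adj y_def using xs i by simp
      moreover have "x \<in> T" "y \<in> T" "x \<noteq> y" using x y T(1) by auto
      ultimately show False using T(3) unfolding indep_def by simp
    qed
    ultimately show ?thesis unfolding maximal_independent_set_def by blast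
  qed
  moreover have "S \<inter> T \<noteq> {}" if "S \<in> F" "T \<in> F" for S T
  proof -
    have "2*s \<in> S \<inter> T" using that assms unfolding F_def M_def I_def by auto
    then show ?thesis by blast
  qed
  ultimately have "system3 t V E F" unfolding system3_def by auto
  moreover have "card F = s"
  proof -
    have "inj_on M {..<s}"
    proof (rule inj_onI)
      fix i j assume ij: "i \<in> {..<s}" "j \<in> {..<s}" "M i = M j"
      have "2*i \<in> M j" using ij(3) unfolding M_def by auto
      then show "i = j" using ij(1) unfolding inM I_def by auto
    qed
    then show ?thesis unfolding F_def by (simp add: card_image)
  qed
  ultimately show ?thesis unfolding system3_edge_counts_def by blast
qed

end

theory Submission
  imports Defs
begin

text \<open>An isolated vertex \<open>v\<close> belongs to every maximal independent set, so
  inserting a new one into the graph and into each member of the family keeps all members maximal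
  independent, and it creates no triangle. Thus every edge count attained for \<open>t\<close> is
  attained for \<open>t + 1\<close> (\<open>system3_edge_counts_mono\<close>), and a minimum over a
  larger set of numbers cannot be larger.\<close>

text \<open>Adding an isolated vertex to the graph and to every set of the family raises \<open>t\<close> by one and
  changes neither the edges nor the size of the family.\<close>

lemma system3_add_isolated_vertex:
  assumes sys: "system3 t V E F" and v: "v \<notin> V"
  shows "system3 (t + 1) (insert v V) E (insert v ` F)"
proof -
  have fin: "finite V" and E: "E \<subseteq> [V]\<^bsup>2\<^esup>" and tri: "triangle_free V E" and F: "F \<subseteq> [V]\<^bsup>t\<^esup>"
    and max: "\<And>S. S \<in> F \<Longrightarrow> maximal_independent_set V E S"
    using sys unfolding system3_def simple_graph_def by auto
  have in_V: "x \<in> V \<and> y \<in> V" if "{x, y} \<in> E" for x y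
    using that E unfolding nsets_def by auto
  have "simple_graph (insert v V) E"
    unfolding simple_graph_def using fin E nsets_mono[of V "insert v V" 2] by blast
  moreover have "triangle_free (insert v V) E"
    unfolding triangle_free_def
  proof
    assume "\<exists>K \<in> [insert v V]\<^bsup>3\<^esup>. clique K E"
    then obtain K where K: "card K = 3" "clique K E" unfolding nsets_def by blast
    then obtain x y z where xyz: "K = {x, y, z}" "x \<noteq> y" "y \<noteq> z" "x \<noteq> z"
      unfolding card_3_iff by blast
    \<comment> \<open>Two edges of the triangle already cover its three vertices, so
      \<open>v\<close>, which lies on no edge, is not among them.\<close>
    then have "{x, y} \<in> E" "{y, z} \<in> E" using K unfolding clique_def by simp_all
    then have "K \<subseteq> V" using in_V xyz by blast
    then have "K \<in> [V]\<^bsup>3\<^esup>" using K fin finite_subset unfolding nsets_def by blast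
    then show False using K tri unfolding triangle_free_def by blast
  qed
  moreover have "insert v ` F \<subseteq> [insert v V]\<^bsup>(t + 1)\<^esup>"
  proof (rule image_subsetI)
    fix S assume "S \<in> F"
    then have S: "S \<subseteq> V" "finite S" "card S = t" using F unfolding nsets_def by auto
    then have "v \<notin> S" using v by blast
    then show "insert v S \<in> [insert v V]\<^bsup>(t + 1)\<^esup>" using S unfolding nsets_def by auto
  qed
  moreover have "maximal_independent_set (insert v V) E (insert v S)" if S: "S \<in> F" for S
  proof -
    have SV: "S \<subseteq> V" and ind: "indep S E"
      and no_larger: "\<And>T. S \<subset> T \<Longrightarrow> T \<subseteq> V \<Longrightarrow> \<not> indep T E"
      using max[OF S] unfolding maximal_independent_set_def by auto
    have "indep (insert v S) E"
      using ind in_V v unfolding indep_def by blast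
    moreover have "\<not> indep T E" if T: "insert v S \<subset> T" "T \<subseteq> insert v V" for T
    proof
      assume "indep T E"
      \<comment> \<open>Deleting \<open>v\<close> from a larger independent set would leave one
        properly containing \<open>S\<close> in the old graph.\<close>
      then have "indep (T - {v}) E" unfolding indep_def by blast
      moreover have "S \<subset> T - {v}" "T - {v} \<subseteq> V" using T SV v by auto
      ultimately show False using no_larger by blast
    qed
    ultimately show ?thesis using SV unfolding maximal_independent_set_def by blast
  qed
  \<comment> \<open>Any two sets of the new family meet in \<open>v\<close>.\<close>
  ultimately show ?thesis unfolding system3_def by auto
qed

text \<open>Freshness of \<open>v\<close> makes \<open>insert v\<close> injective on
  \<open>F\<close>, so no two members of the family are merged.\<close>

lemma card_image_insert_fresh:
  assumes "F \<subseteq> Pow V" "v \<notin> V"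
  shows "card (insert v ` F) = card F"
proof (rule card_image, rule inj_onI)
  fix S T assume "S \<in> F" "T \<in> F" "insert v S = insert v T"
  moreover from this have "v \<notin> S" "v \<notin> T" using assms by auto
  ultimately show "S = T" by (metis insert_ident)
qed

lemma system3_edge_counts_mono: "system3_edge_counts t s \<subseteq> system3_edge_counts (t + 1) s"
proof
  fix n assume "n \<in> system3_edge_counts t s"
  then obtain V :: "nat set" and E F where
    n: "n = card E" and sys: "system3 t V E F" and F: "card F = s"
    unfolding system3_edge_counts_def by blast
  have "finite V" "F \<subseteq> Pow V"
    using sys unfolding system3_def simple_graph_def nsets_def by auto
  \<comment> \<open>The vertices are natural numbers, so a finite graph always leaves one
    free.\<close>
  then obtain v where v: "v \<notin> V" using ex_new_if_finite[OF infinite_UNIV_nat] by blast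
  have "card (insert v ` F) = s"
    using card_image_insert_fresh[OF \<open>F \<subseteq> Pow V\<close> v] F by simp
  with system3_add_isolated_vertex[OF sys v] n
  show "n \<in> system3_edge_counts (t + 1) s"
    unfolding system3_edge_counts_def by blast
qed

theorem theorem15:
  fixes t s :: nat
  assumes "t \<ge> 3"
  shows "e3 (t + 1) s \<le> e3 t s"
  unfolding e3_def
  \<comment> \<open>Here \<open>t \<ge> 3\<close> enters: it makes the set of counts for
    \<open>t\<close> nonempty, which rules out the default \<open>Inf {} = 0\<close> on the
    right.\<close>
  by (rule cInf_superset_mono[OF system3_edge_counts_nonempty[OF assms] _ system3_edge_counts_mono])
    simp

end
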